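(* Let $G$ be a bipartite graph without isolated vertices, of order $n \geq 6$, with domination number $\gamma(G)=2$, and having exactly one minimum dominating set. Then the number of edges of $G$ satisfies $$s(G) \leq \begin{cases} \frac{n(n-2)}{4}, & \text{if } n \text{ is even},\\[2pt] \frac{(n-1)^2}{4}, & \text{if } n \text{ is odd.}\end{cases}$$
   Context: All graphs are finite and simple. A dominating set of a graph $G=(V,E)$ is a set $D\subseteq V$ such that every vertex of $V\setminus D$ is adjacent to some vertex of $D$; the domination number $\gamma(G)$ is the minimum size of a dominating set, and a minimum dominating set is a dominating set of size $\gamma(G)$. $s(G)$ denotes the number of edges of $G$. *)

theory Defs
  imports Complex_Main "Graph_Theory.Digraph"
begin

text \<open>
  Finite simple graphs are the members of the locale \<^locale>\<open>graph\<close>: finite, loop-free,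
  symmetric digraphs without parallel arcs. Adjacency of \<open>u\<close> and \<open>v\<close> is \<open>u \<rightarrow>\<^bsub>G\<^esub> v\<close>.
  Each undirected edge is represented there by two opposite arcs, so edges are counted below
  as unordered pairs.
\<close>

definition edges :: "('a, 'b) pre_digraph \<Rightarrow> 'a set set" where
  "edges G = {{u, v} | u v. u \<rightarrow>\<^bsub>G\<^esub> v}"

definition num_edges :: "('a, 'b) pre_digraph \<Rightarrow> nat" where
  "num_edges G = card (edges G)"

definition bipartite :: "('a, 'b) pre_digraph \<Rightarrow> bool" where
  "bipartite G \<longleftrightarrow> (\<exists>X Y. verts G = X \<union> Y \<and> X \<inter> Y = {} \<and>
     (\<forall>u v. u \<rightarrow>\<^bsub>G\<^esub> v \<longrightarrow> (u \<in> X \<and> v \<in> Y) \<or> (u \<in> Y \<and> v \<in> X)))"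

definition isolated_vertex :: "('a, 'b) pre_digraph \<Rightarrow> 'a \<Rightarrow> bool" where
  "isolated_vertex G v \<longleftrightarrow> v \<in> verts G \<and> \<not> (\<exists>u. v \<rightarrow>\<^bsub>G\<^esub> u)"

definition dominating_set :: "('a, 'b) pre_digraph \<Rightarrow> 'a set \<Rightarrow> bool" where
  "dominating_set G D \<longleftrightarrow> D \<subseteq> verts G \<and> (\<forall>v \<in> verts G - D. \<exists>u \<in> D. v \<rightarrow>\<^bsub>G\<^esub> u)"

definition domination_number :: "('a, 'b) pre_digraph \<Rightarrow> nat" where
  "domination_number G = (LEAST k. \<exists>D. dominating_set G D \<and> card D = k)"

definition minimum_dominating_set :: "('a, 'b) pre_digraph \<Rightarrow> 'a set \<Rightarrow> bool" where
  "minimum_dominating_set G D \<longleftrightarrow> dominating_set G D \<and> card D = domination_number G"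

end

theory Submission
  imports Defs
begin

text \<open>
  Let \<open>X\<close>, \<open>Y\<close> be the two sides and \<open>M\<close> the set of non-adjacent pairs in \<open>X \<times> Y\<close>. If \<open>x\<close> has no
  non-neighbour in \<open>Y\<close> other than \<open>y\<close>, and \<open>y\<close> none in \<open>X\<close> other than \<open>x\<close>, then \<open>{x, y}\<close> is
  dominating; so there is at most one such pair. This forces \<open>|M| \<ge> min |X| |Y|\<close>: otherwise some
  \<open>x\<close> and some \<open>y\<close> are adjacent to the whole opposite side, by uniqueness they are the only
  vertices with this property, hence \<open>M\<close> is a perfect matching between \<open>X - {x}\<close> and \<open>Y - {y}\<close>, and
  any pair in that matching is a second dominating pair. The number of edges is therefore at most
  \<open>a * b\<close> for some \<open>a + b = n - 1\<close>, and AM-GM finishes the proof.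
\<close>

text \<open>Graph-free counting core, with \<open>M\<close> as the non-edges: \<open>unique\<close>
  encodes that at most one pair has no non-neighbours across except possibly each other.\<close>

lemma card_ge_min_if_unique_private_pair:
  assumes "finite X" "finite Y" and M: "M \<subseteq> X \<times> Y" and big: "card X + card Y > 2"
    and unique: "\<And>x y x' y'. \<lbrakk>x \<in> X; y \<in> Y; x' \<in> X; y' \<in> Y;
      \<And>u v. (u, v) \<in> M \<Longrightarrow> u = x \<longleftrightarrow> v = y;
      \<And>u v. (u, v) \<in> M \<Longrightarrow> u = x' \<longleftrightarrow> v = y'\<rbrakk> \<Longrightarrow> x = x' \<and> y = y'"
  shows "min (card X) (card Y) \<le> card M"
proof (rule ccontr)
  assume "\<not> ?thesis"
  then have less: "card M < card X" "card M < card Y" by auto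
  have fin: "finite M" using M assms(1,2) by (meson finite_SigmaI finite_subset)
  have "\<not> X \<subseteq> fst ` M" "\<not> Y \<subseteq> snd ` M"
    using less fin by (meson card_image_le card_mono finite_imageI leD le_trans)+
  then obtain x y where xy: "x \<in> X" "x \<notin> fst ` M" "y \<in> Y" "y \<notin> snd ` M" by blast
  have "X - {x} \<subseteq> fst ` M"
  proof
    fix x' assume x': "x' \<in> X - {x}"
    show "x' \<in> fst ` M"
    proof (rule ccontr)
      assume "x' \<notin> fst ` M"
      \<comment> \<open>Neither \<open>x\<close>, \<open>x'\<close> nor \<open>y\<close> occurs in
        \<open>M\<close>, so for \<open>(x, y)\<close> and \<open>(x', y)\<close> both sides of each
        equivalence in \<open>unique\<close> are false.\<close>
      then have "x = x' \<and> y = y"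
        using x' xy by (intro unique) (force intro: rev_image_eqI)+
      with x' show False by simp
    qed
  qed
  then have cX: "card X - 1 \<le> card (fst ` M)"
    using fin xy assms(1) by (metis card_Diff_singleton card_mono finite_imageI)
  have "Y - {y} \<subseteq> snd ` M"
  proof
    fix y' assume y': "y' \<in> Y - {y}"
    show "y' \<in> snd ` M"
    proof (rule ccontr)
      assume "y' \<notin> snd ` M"
      then have "x = x \<and> y = y'"
        using y' xy by (intro unique) (force intro: rev_image_eqI)+
      with y' show False by simp
    qed
  qed
  then have cY: "card Y - 1 \<le> card (snd ` M)"
    using fin xy assms(2) by (metis card_Diff_singleton card_mono finite_imageI)
  have le: "card (fst ` M) \<le> card M" "card (snd ` M) \<le> card M"
    using fin by (auto intro: card_image_le)
  \<comment> \<open>\<open>card M\<close> is at most \<open>card X - 1\<close> and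
    \<open>card Y - 1\<close>, so \<open>cX\<close>, \<open>cY\<close> and \<open>le\<close> are
    equalities and both projections preserve cardinality.\<close>
  have inj: "inj_on fst M" "inj_on snd M"
    using fin le cX cY less by (auto intro!: eq_card_imp_inj_on)
  have "card M > 0" using le cX cY less big by linarith
  then have "M \<noteq> {}" by auto
  then obtain x' y' where x'y': "(x', y') \<in> M" by (metis ex_in_conv surj_pair)
  \<comment> \<open>By injectivity no other pair of \<open>M\<close> shares a coordinate with
    \<open>(x', y')\<close>, so this pair too qualifies for \<open>unique\<close>.\<close>
  have "x = x' \<and> y = y'"
  proof (rule unique)
    show "u = x' \<longleftrightarrow> v = y'" if "(u, v) \<in> M" for u v
      using inj_onD[OF inj(1) _ that x'y'] inj_onD[OF inj(2) _ that x'y'] by auto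
  qed (use xy x'y' M in \<open>force intro: rev_image_eqI\<close>)+
  with xy x'y' show False by (force intro: rev_image_eqI)
qed

text \<open>If \<open>p\<close> is the minimum, then \<open>e\<close> is at most
  \<open>p * (q - 1)\<close>, and symmetrically for \<open>q\<close>; the two factors sum to
  \<open>p + q - 1\<close>, so AM-GM applies. Working in \<open>int\<close> avoids truncated
  subtraction.\<close>

lemma four_mult_le_if_deficit_min:
  fixes p q e m :: nat
  assumes "p * q = e + m" "min p q \<le> m"
  shows "4 * int e \<le> (int (p + q) - 1)\<^sup>2"
proof -
  have amgm: "4 * (a * b) \<le> (a + b)\<^sup>2" for a b :: int
    using zero_le_power2[of "a - b"] by (simp add: power2_eq_square algebra_simps)
  have pq: "int e + int m = int p * int q" using assms(1) by (metis of_nat_add of_nat_mult)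
  have "int e \<le> int p * (int q - 1) \<or> int e \<le> (int p - 1) * int q"
    using assms(2) pq by (auto simp: algebra_simps min_def split: if_splits)
  then show ?thesis
    using amgm[of "int p" "int q - 1"] amgm[of "int p - 1" "int q"]
    by (auto simp: algebra_simps)
qed

theorem theorem2p10:
  fixes G :: "('a, 'b) pre_digraph" and n :: nat
  assumes "graph G"
    and "bipartite G"
    and "\<not> (\<exists>v. isolated_vertex G v)"
    and "card (verts G) = n" and "n \<ge> 6"
    and "domination_number G = 2"
    and "\<exists>!D. minimum_dominating_set G D"
  shows "real (num_edges G) \<le>
    (if even n then real n * (real n - 2) / 4 else (real n - 1)\<^sup>2 / 4)"
proof -
  interpret graph G by fact
  obtain X Y where XY: "verts G = X \<union> Y" "X \<inter> Y = {}"
    and bip: "\<And>u v. u \<rightarrow>\<^bsub>G\<^esub> v \<Longrightarrow> (u \<in> X \<and> v \<in> Y) \<or> (u \<in> Y \<and> v \<in> X)"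
    using assms(2) unfolding bipartite_def by metis
  have fin: "finite X" "finite Y" using XY(1) finite_verts by (metis finite_Un)+
  have n: "n = card X + card Y" using card_Un_disjoint[OF fin XY(2)] XY(1) assms(4) by simp
  have sym: "u \<rightarrow>\<^bsub>G\<^esub> v \<Longrightarrow> v \<rightarrow>\<^bsub>G\<^esub> u" for u v
    using sym_arcs by (auto simp: symmetric_def elim: symE)
  define E where "E = {(u, v) \<in> X \<times> Y. u \<rightarrow>\<^bsub>G\<^esub> v}"
  define M where "M = X \<times> Y - E"
  have E: "E \<subseteq> X \<times> Y" unfolding E_def by blast
  have finE: "finite E" using E fin by (meson finite_SigmaI finite_subset)
  have EM: "card X * card Y = card E + card M"
    unfolding M_def using E finE fin
    by (metis card_Diff_subset card_cartesian_product card_mono finite_SigmaI le_add_diff_inverse)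
  have "edges G \<subseteq> (\<lambda>(u, v). {u, v}) ` E"
  proof
    fix e assume "e \<in> edges G"
    then obtain u v where uv: "e = {u, v}" "u \<rightarrow>\<^bsub>G\<^esub> v" unfolding edges_def by blast
    then have "(u, v) \<in> E \<or> (v, u) \<in> E" using bip[OF uv(2)] sym[OF uv(2)] unfolding E_def by blast
    with uv(1) show "e \<in> (\<lambda>(u, v). {u, v}) ` E" by (auto simp: image_iff insert_commute)
  qed
  then have edges_le: "num_edges G \<le> card E"
    unfolding num_edges_def using finE by (meson card_image_le card_mono finite_imageI le_trans)
  have mds: "minimum_dominating_set G {x, y}"
    if "x \<in> X" "y \<in> Y" and iff: "\<And>u v. (u, v) \<in> M \<Longrightarrow> u = x \<longleftrightarrow> v = y" for x y
  proof -
    have "\<exists>u\<in>{x, y}. v \<rightarrow>\<^bsub>G\<^esub> u" if v: "v \<in> verts G - {x, y}" for v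
    proof (cases "v \<in> X")
      case True
      \<comment> \<open>Membership would force \<open>v = x\<close> by \<open>iff\<close>.\<close>
      then have "(v, y) \<notin> M" using iff v by blast
      then show ?thesis using True \<open>y \<in> Y\<close> unfolding M_def E_def by blast
    next
      case False
      then have "v \<in> Y" using v XY by blast
      moreover have "(x, v) \<notin> M" using iff v by blast
      ultimately show ?thesis using \<open>x \<in> X\<close> sym unfolding M_def E_def by blast
    qed
    moreover have "x \<noteq> y" using that XY by blast
    ultimately show ?thesis
      using that XY assms(6) unfolding minimum_dominating_set_def dominating_set_def by auto
  qed
  have "min (card X) (card Y) \<le> card M"
  proof (rule card_ge_min_if_unique_private_pair[OF fin])
    show "M \<subseteq> X \<times> Y" unfolding M_def by blast
    show "card X + card Y > 2" using n assms(5) by simp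
    show "x = x' \<and> y = y'" if "x \<in> X" "y \<in> Y" "x' \<in> X" "y' \<in> Y"
      "\<And>u v. (u, v) \<in> M \<Longrightarrow> u = x \<longleftrightarrow> v = y" "\<And>u v. (u, v) \<in> M \<Longrightarrow> u = x' \<longleftrightarrow> v = y'" for x y x' y'
    proof -
      have "{x, y} = {x', y'}"
        using mds[OF that(1,2,5)] mds[OF that(3,4,6)] assms(7) by blast
      \<comment> \<open>Disjointness of \<open>X\<close> and \<open>Y\<close> excludes the crossed
        case \<open>x = y'\<close>.\<close>
      then show ?thesis using that(1-4) XY by (auto simp: doubleton_eq_iff)
    qed
  qed
  then have "4 * int (card E) \<le> (int n - 1)\<^sup>2"
    using four_mult_le_if_deficit_min[OF EM] n by simp
  then have main: "4 * int (num_edges G) \<le> (int n - 1)\<^sup>2" using edges_le by linarith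
  show ?thesis
  proof (cases "even n")
    case True
    then obtain k where k: "int n = 2 * k" by (auto elim!: evenE)
    have "4 * int (num_edges G) \<le> 4 * (k * k - k) + 1"
      using main by (simp add: k power2_eq_square algebra_simps)
    then have "4 * int (num_edges G) \<le> 4 * (k * k - k)" by presburger
    also have "\<dots> = int n * (int n - 2)" by (simp add: k algebra_simps)
    finally have "real_of_int (4 * int (num_edges G)) \<le> real_of_int (int n * (int n - 2))"
      by (simp only: of_int_le_iff)
    then show ?thesis using True by simp
  next
    case False
    have "real_of_int (4 * int (num_edges G)) \<le> real_of_int ((int n - 1)\<^sup>2)"
      using main by (simp only: of_int_le_iff)
    then show ?thesis using False by simp
  qed
qed

end
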